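(* For any $k\geq 4$, there does not exist a total $k$-uniform connected chordal graph.
   Context: All graphs are finite and simple. A graph is chordal if it has no induced cycle of length at least 4. $N(v)$ is the set of neighbors of $v$. For a graph $G$ with no isolated vertices, a total dominating set is a set $A\subseteq V(G)$ such that every vertex of $G$ has a neighbor in $A$; $\gamma_t(G)$ is the minimum size of one. A sequence $(v_1,\dots,v_m)$ of distinct vertices is legal if $N(v_i)\setminus\bigcup_{j=1}^{i-1}N(v_j)\neq\emptyset$ for every $i\in\{2,\dots,m\}$; it is a total dominating sequence if moreover $\{v_1,\dots,v_m\}$ is a total dominating set. $\gamma_{gr}^t(G)$ is the maximum length of a total dominating sequence. $G$ is total $k$-uniform if $\gamma_t(G)=\gamma_{gr}^t(G)=k$. *)

theory Defs
  imports "Graph_Theory.Digraph_Component"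
begin

text \<open>
  A finite simple graph is a \<^term>\<open>graph G\<close> of the library: a finite symmetric digraph without
  loops and without parallel arcs, an edge being a pair of opposite arcs.
\<close>

definition neighbors :: "('a, 'b) pre_digraph \<Rightarrow> 'a \<Rightarrow> 'a set" where
  "neighbors G v = {u. v \<rightarrow>\<^bsub>G\<^esub> u}"

text \<open>
  The list \<open>c\<close> enumerates the vertices of an induced cycle in cyclic order: two of them are
  adjacent exactly when they are cyclically consecutive. This is a cycle in the graph-theoretic
  sense only for length at least 3.
\<close>

definition induced_cycle :: "('a, 'b) pre_digraph \<Rightarrow> 'a list \<Rightarrow> bool" where
  "induced_cycle G c \<longleftrightarrow>
     3 \<le> length c \<and> distinct c \<and> set c \<subseteq> verts G \<and>
     (\<forall>i < length c. \<forall>j < length c.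
        c ! i \<rightarrow>\<^bsub>G\<^esub> c ! j \<longleftrightarrow> j = Suc i mod length c \<or> i = Suc j mod length c)"

definition chordal :: "('a, 'b) pre_digraph \<Rightarrow> bool" where
  "chordal G \<longleftrightarrow> \<not> (\<exists>c. induced_cycle G c \<and> 4 \<le> length c)"

definition no_isolated :: "('a, 'b) pre_digraph \<Rightarrow> bool" where
  "no_isolated G \<longleftrightarrow> (\<forall>v \<in> verts G. neighbors G v \<noteq> {})"

definition total_dominating_set :: "('a, 'b) pre_digraph \<Rightarrow> 'a set \<Rightarrow> bool" where
  "total_dominating_set G A \<longleftrightarrow>
     A \<subseteq> verts G \<and> (\<forall>v \<in> verts G. \<exists>u \<in> A. u \<in> neighbors G v)"

definition legal :: "('a, 'b) pre_digraph \<Rightarrow> 'a list \<Rightarrow> bool" where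
  "legal G vs \<longleftrightarrow>
     distinct vs \<and> set vs \<subseteq> verts G \<and>
     (\<forall>i \<in> {1..<length vs}. neighbors G (vs ! i) - (\<Union>j<i. neighbors G (vs ! j)) \<noteq> {})"

definition total_dominating_seq :: "('a, 'b) pre_digraph \<Rightarrow> 'a list \<Rightarrow> bool" where
  "total_dominating_seq G vs \<longleftrightarrow> legal G vs \<and> total_dominating_set G (set vs)"

text \<open>
  The following two numbers are meaningful only for finite graphs without isolated vertices, where
  the sets are finite and non-empty; hence the condition in \<open>total_uniform\<close>.
\<close>

definition total_domination_number :: "('a, 'b) pre_digraph \<Rightarrow> nat" where
  "total_domination_number G = Min (card ` {A. total_dominating_set G A})"

definition grundy_total_domination_number :: "('a, 'b) pre_digraph \<Rightarrow> nat" where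
  "grundy_total_domination_number G = Max (length ` {vs. total_dominating_seq G vs})"

definition total_uniform :: "nat \<Rightarrow> ('a, 'b) pre_digraph \<Rightarrow> bool" where
  "total_uniform k G \<longleftrightarrow>
     no_isolated G \<and> total_domination_number G = k \<and> grundy_total_domination_number G = k"

end

theory Submission
  imports Defs
begin

text \<open>
  Uniformity says that the closure \<open>S \<mapsto> {v. N(v) \<subseteq> N(S)}\<close> on vertices has the exchange property,
  so it is a matroid of rank \<open>k\<close>. Non-adjacency is a polarity of its lattice of flats in which every
  vertex is orthogonal to itself; the lattice is therefore self-dual and modular, and every line
  meets every hyperplane of non-neighbours of a vertex. A connected chordal graph has a simplicial
  vertex \<open>v\<close>. If \<open>v\<close> is not a leaf, then comparing \<open>v\<close> with such intersection points shows that \<open>v\<close>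
  lies on the line through any two of its neighbours \<open>a, b\<close>, and that this line is closed under
  adjacency. Hence it contains all vertices, and the rank is at most 2.
\<close>

section \<open>Simplicial vertices of chordal graphs\<close>

context graph
begin

lemma adj_sym: "x \<rightarrow> y \<longleftrightarrow> y \<rightarrow> x"
  by (metis graph_symmetric)

lemma adj_irrefl: "\<not> x \<rightarrow> x"
  by (metis adj_not_same)

lemma in_neighbors_iff: "y \<in> neighbors G x \<longleftrightarrow> x \<rightarrow> y"
  by (simp add: neighbors_def)

text \<open>The relation lets arcs start only in \<open>insert b X\<close> and end only in
  \<open>insert b' X\<close>, so a walk from \<open>b\<close> to \<open>b'\<close> passes through
  \<open>X\<close> in between. One of least length has no repeated vertex and no chord.\<close>

lemma shortest_path_through:
  assumes ne: "b \<noteq> b'" and bX: "b \<notin> X" "b' \<notin> X"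
    and reach: "(b, b') \<in> {(x, y). x \<rightarrow> y \<and> x \<in> insert b X \<and> y \<in> insert b' X}\<^sup>*"
  obtains p n where "p 0 = b" "p n = b'"
    "\<And>i. 0 < i \<Longrightarrow> i < n \<Longrightarrow> p i \<in> X"
    "\<And>i j. i < j \<Longrightarrow> j \<le> n \<Longrightarrow> p i \<noteq> p j"
    "\<And>i j. i < j \<Longrightarrow> j \<le> n \<Longrightarrow> p i \<rightarrow> p j \<longleftrightarrow> j = Suc i"
proof -
  define Q where "Q = {(x, y). x \<rightarrow> y \<and> x \<in> insert b X \<and> y \<in> insert b' X}"
  define n where "n = (LEAST n. (b, b') \<in> Q ^^ n)"
  have "\<exists>n. (b, b') \<in> Q ^^ n"
    using reach by (simp add: Q_def rtrancl_power)
  then have n: "(b, b') \<in> Q ^^ n"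
    unfolding n_def by (rule LeastI_ex)
  have least: "n \<le> m" if "(b, b') \<in> Q ^^ m" for m
    unfolding n_def using that by (rule Least_le)
  obtain p where p0: "p 0 = b" and pn: "p n = b'"
    and step: "\<And>i. i < n \<Longrightarrow> (p i, p (Suc i)) \<in> Q"
    using n unfolding relpow_fun_conv by blast
  have pre: "p i \<in> insert b X" if "i < n" for i
    using step[OF that] by (auto simp: Q_def)
  have post: "p i \<in> insert b' X" if "0 < i" "i \<le> n" for i
    using step[of "i - 1"] that by (auto simp: Q_def)
  have inner: "p i \<in> X" if "0 < i" "i < n" for i
    using pre[of i] post[of i] that ne by auto
  have chord: "j = Suc i" if "i < j" "j \<le> n" "p i \<rightarrow> p j" for i j
  proof -
    \<comment> \<open>An arc from \<open>p i\<close> to \<open>p j\<close> replaces the stretch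
      between them by one step; minimality of \<open>n\<close> then forces
      \<open>j \<le> Suc i\<close>.\<close>
    have "(b, p i) \<in> Q ^^ i"
      unfolding relpow_fun_conv using p0 step that by (intro exI[of _ p]) auto
    moreover have "(p i, p j) \<in> Q"
      using that pre[of i] post[of j] by (auto simp: Q_def)
    moreover have "(p j, b') \<in> Q ^^ (n - j)"
      unfolding relpow_fun_conv using pn step that
      by (intro exI[of _ "\<lambda>t. p (j + t)"]) auto
    ultimately have "(b, b') \<in> Q ^^ (Suc i + (n - j))"
      unfolding relpow_add by auto
    from least[OF this] show ?thesis using that by simp
  qed
  have inj: "p i \<noteq> p j" if "i < j" "j \<le> n" for i j
  proof
    assume eq: "p i = p j"
    show False
    proof (cases "j = n")
      case True
      with eq that pn inner[of i] p0 ne bX show False by (cases "i = 0") auto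
    next
      case False
      then have "p i \<rightarrow> p (Suc j)" using step[of j] that eq by (simp add: Q_def)
      then show False using chord[of i "Suc j"] that False by simp
    qed
  qed
  have adj: "p i \<rightarrow> p j \<longleftrightarrow> j = Suc i" if "i < j" "j \<le> n" for i j
    using chord[of i j] step[of i] that by (auto simp: Q_def)
  show thesis
    by (rule that[of p n]) (use p0 pn inner inj adj in auto)
qed

text \<open>Otherwise a shortest path from \<open>b\<close> to \<open>b'\<close> through
  \<open>X\<close> has at least two arcs, and \<open>c\<close>, which sees only its ends, closes it
  to an induced cycle of length at least 4.\<close>

lemma chordal_common_boundary_adj:
  assumes ch: "chordal G" and ne: "b \<noteq> b'" and bX: "b \<notin> X" "b' \<notin> X"
    and reach: "(b, b') \<in> {(x, y). x \<rightarrow> y \<and> x \<in> insert b X \<and> y \<in> insert b' X}\<^sup>*"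
    and c: "c \<rightarrow> b" "c \<rightarrow> b'" "\<And>x. x \<in> X \<Longrightarrow> \<not> c \<rightarrow> x" and cX: "c \<notin> X"
    and XV: "X \<subseteq> verts G"
  shows "b \<rightarrow> b'"
proof (rule ccontr)
  assume nadj: "\<not> b \<rightarrow> b'"
  show False
  proof (rule shortest_path_through[OF ne bX reach])
    fix p :: "nat \<Rightarrow> 'a" and n
    assume p0: "p 0 = b" and pn: "p n = b'"
      and inner: "\<And>i. 0 < i \<Longrightarrow> i < n \<Longrightarrow> p i \<in> X"
      and inj: "\<And>i j. i < j \<Longrightarrow> j \<le> n \<Longrightarrow> p i \<noteq> p j"
      and adj: "\<And>i j. i < j \<Longrightarrow> j \<le> n \<Longrightarrow> p i \<rightarrow> p j \<longleftrightarrow> j = Suc i"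
    have n2: "2 \<le> n"
    proof -
      have "n \<noteq> 0" using p0 pn ne by metis
      moreover have "n \<noteq> 1" using adj[of 0 1] nadj p0 pn by auto
      ultimately show ?thesis by simp
    qed
    have cpi: "c \<rightarrow> p i \<longleftrightarrow> i = 0 \<or> i = n" if "i \<le> n" for i
      using that c inner[of i] p0 pn by (cases "i = 0 \<or> i = n") auto
    have cne: "p i \<noteq> c" if "i \<le> n" for i
      using that inner[of i] cX p0 pn c adj_irrefl by (cases "i = 0 \<or> i = n") auto
    have pV: "p i \<in> verts G" if "i \<le> n" for i
      using that inner[of i] XV p0 pn c adj_in_verts(2) by (cases "i = 0 \<or> i = n") auto
    have padj: "p i \<rightarrow> p j \<longleftrightarrow> j = Suc i \<or> i = Suc j" if "i \<le> n" "j \<le> n" for i j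
      using adj[of i j] adj[of j i] that adj_irrefl[of "p i"] adj_sym[of "p i" "p j"]
      by (cases i j rule: linorder_cases) auto
    define cyc where "cyc = map p [0..<Suc n] @ [c]"
    have len: "length cyc = n + 2" by (simp add: cyc_def)
    have nth: "cyc ! i = (if i \<le> n then p i else c)" if "i < n + 2" for i
      using that by (auto simp: cyc_def nth_append simp del: upt_Suc)
    have "inj_on p {0..<Suc n}"
      by (rule inj_onI) (metis atLeastLessThan_iff inj less_Suc_eq_le linorder_neqE_nat)
    then have "distinct cyc"
      using cne by (fastforce simp: cyc_def distinct_map less_Suc_eq_le simp del: upt_Suc)
    moreover have "set cyc \<subseteq> verts G"
      using pV c(1) adj_in_verts(1) by (auto simp: cyc_def simp del: upt_Suc)
    moreover have "cyc ! i \<rightarrow> cyc ! j \<longleftrightarrow>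
        j = Suc i mod length cyc \<or> i = Suc j mod length cyc"
      if "i < length cyc" "j < length cyc" for i j
    proof -
      have ij: "i < n + 2" "j < n + 2" using that len by auto
      have m: "Suc t mod (n + 2) = (if t = Suc n then 0 else Suc t)" if "t < n + 2" for t
        using that by auto
      consider "i \<le> n" "j \<le> n" | "i \<le> n" "j = Suc n" | "i = Suc n" "j \<le> n" | "i = Suc n" "j = Suc n"
        using ij by linarith
      then show ?thesis
      proof cases
        case 1
        then show ?thesis using padj[of i j] nth[of i] nth[of j] m[of i] m[of j] len ij by auto
      next
        case 2
        then show ?thesis
          using cpi[of i] nth[of i] nth[of j] m[of i] m[of j] len ij adj_sym[of c "p i"] by auto
      next
        case 3
        then show ?thesis
          using cpi[of j] nth[of i] nth[of j] m[of i] m[of j] len ij by auto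
      next
        case 4
        then show ?thesis using nth[of i] m[of i] len ij adj_irrefl by auto
      qed
    qed
    ultimately have "induced_cycle G cyc"
      using len n2 unfolding induced_cycle_def by simp
    then show False using ch len n2 unfolding chordal_def by auto
  qed
qed

text \<open>
  Let \<open>X\<close> be a maximal connected subset of \<open>W\<close> whose closed neighbourhood misses a vertex of \<open>W\<close>, and
  let \<open>C\<close> be the set of missed vertices. By maximality every boundary vertex of \<open>X\<close> is adjacent to
  all of \<open>C\<close>, so by chordality the boundary is a clique, and a vertex that is simplicial in \<open>C\<close>
  is simplicial in \<open>W\<close>.
\<close>

lemma chordal_ex_simplicial:
  assumes ch: "chordal G" and "W \<subseteq> verts G" "W \<noteq> {}"
  shows "\<exists>v \<in> W. \<forall>x \<in> W. \<forall>y \<in> W. v \<rightarrow> x \<longrightarrow> v \<rightarrow> y \<longrightarrow> x \<noteq> y \<longrightarrow> x \<rightarrow> y"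
  using assms(2,3)
proof (induction "card W" arbitrary: W rule: less_induct)
  case less
  note WV = less.prems(1)
  have finW: "finite W" using WV finite_verts by (rule finite_subset)
  show ?case
  proof (cases "\<forall>x \<in> W. \<forall>y \<in> W. x \<noteq> y \<longrightarrow> x \<rightarrow> y")
    case True
    then show ?thesis using less.prems by blast
  next
    case False
    then obtain u v where uv: "u \<in> W" "v \<in> W" "u \<noteq> v" "\<not> v \<rightarrow> u" by (metis adj_sym)
    define R where "R X = {(x, y). x \<rightarrow> y \<and> x \<in> X \<and> y \<in> X}" for X
    define far where "far X = {c \<in> W. c \<notin> X \<and> (\<forall>x \<in> X. \<not> c \<rightarrow> x)}" for X
    define good where
      "good X \<longleftrightarrow> X \<subseteq> W \<and> v \<in> X \<and> (\<forall>x \<in> X. (v, x) \<in> (R X)\<^sup>*) \<and> far X \<noteq> {}" for X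
    have "good {v}"
      using uv adj_sym by (auto simp: good_def far_def)
    moreover have "\<forall>X. good X \<longrightarrow> card X < Suc (card W)"
      using finW by (auto simp: good_def less_Suc_eq_le intro: card_mono)
    ultimately obtain X where gX: "good X" and max: "\<And>Y. good Y \<Longrightarrow> card Y \<le> card X"
      using ex_has_greatest_nat[of good "{v}" card "Suc (card W)"] by metis
    have XW: "X \<subseteq> W" and vX: "v \<in> X" and con: "\<And>x. x \<in> X \<Longrightarrow> (v, x) \<in> (R X)\<^sup>*"
      and farX: "far X \<noteq> {}"
      using gX by (auto simp: good_def)
    have finX: "finite X" using XW finW by (rule finite_subset)
    \<comment> \<open>\<open>far X\<close> misses \<open>v\<close>, so the induction hypothesis
      provides a vertex \<open>s\<close> simplicial in \<open>far X\<close>.\<close>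
    have "far X \<subset> W" using vX uv by (auto simp: far_def)
    then have "card (far X) < card W" using finW by (rule psubset_card_mono[rotated])
    moreover have "far X \<subseteq> verts G" using WV by (auto simp: far_def)
    ultimately obtain s where s: "s \<in> far X"
      and simp: "\<And>x y. x \<in> far X \<Longrightarrow> y \<in> far X \<Longrightarrow> s \<rightarrow> x \<Longrightarrow> s \<rightarrow> y \<Longrightarrow> x \<noteq> y \<Longrightarrow> x \<rightarrow> y"
      using less.hyps[of "far X"] farX by metis
    have nbX: "b \<notin> X" if "s \<rightarrow> b" for b
      using s that by (auto simp: far_def)
    have bnd: "\<exists>x \<in> X. b \<rightarrow> x" if "b \<in> W" "s \<rightarrow> b" "b \<notin> far X" for b
      using that nbX[of b] by (auto simp: far_def)
    have full: "c \<rightarrow> b" if b: "b \<in> W" "s \<rightarrow> b" "b \<notin> far X" and c: "c \<in> far X" for b c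
    proof (rule ccontr)
      assume nadj: "\<not> c \<rightarrow> b"
      obtain x where x: "x \<in> X" "b \<rightarrow> x" using bnd[OF b] by blast
      have mono: "(R X)\<^sup>* \<subseteq> (R (insert b X))\<^sup>*"
        by (rule rtrancl_mono) (auto simp: R_def)
      have "(v, x) \<in> (R (insert b X))\<^sup>*" using con[OF x(1)] mono by blast
      moreover have "(x, b) \<in> R (insert b X)" using x adj_sym by (auto simp: R_def)
      ultimately have "(v, b) \<in> (R (insert b X))\<^sup>*" by (rule rtrancl_into_rtrancl)
      \<comment> \<open>The vertex \<open>c\<close> witnesses that the larger connected set
        \<open>insert b X\<close> is still good, against maximality.\<close>
      moreover have "c \<in> far (insert b X)" using c b(3) nadj by (auto simp: far_def)
      ultimately have "good (insert b X)"
        using XW vX con mono b(1) unfolding good_def by blast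
      from max[OF this] show False using finX nbX[OF b(2)] by simp
    qed
    have "x \<rightarrow> y" if xy: "x \<in> W" "y \<in> W" "s \<rightarrow> x" "s \<rightarrow> y" "x \<noteq> y" for x y
    proof -
      consider "x \<in> far X" "y \<in> far X" | "x \<in> far X" "y \<notin> far X" | "x \<notin> far X" "y \<in> far X"
        | "x \<notin> far X" "y \<notin> far X" by blast
      then show ?thesis
      proof cases
        case 1
        then show ?thesis using simp xy by blast
      next
        case 2
        then show ?thesis using full[of y x] xy by blast
      next
        case 3
        then show ?thesis using full[of x y] xy adj_sym by blast
      next
        case 4
        \<comment> \<open>Both \<open>x\<close> and \<open>y\<close> lie on the boundary of
          \<open>X\<close>. Connectedness of \<open>X\<close> joins them through \<open>X\<close>,
          while \<open>s\<close> sees both of them and nothing in \<open>X\<close>.\<close>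
        obtain p where p: "p \<in> X" "x \<rightarrow> p" using bnd xy 4 by blast
        obtain q where q: "q \<in> X" "y \<rightarrow> q" using bnd xy 4 by blast
        define Q where "Q = {(a, a'). a \<rightarrow> a' \<and> a \<in> insert x X \<and> a' \<in> insert y X}"
        have "sym (R X)" using adj_sym by (auto simp: sym_def R_def)
        then have "(p, v) \<in> (R X)\<^sup>*" using con[OF p(1)] by (meson sym_rtrancl symD)
        then have "(p, q) \<in> (R X)\<^sup>*" using con[OF q(1)] by (rule rtrancl_trans)
        moreover have "(R X)\<^sup>* \<subseteq> Q\<^sup>*" by (rule rtrancl_mono) (auto simp: R_def Q_def)
        ultimately have "(p, q) \<in> Q\<^sup>*" by blast
        moreover have "(x, p) \<in> Q" using p by (auto simp: Q_def)
        moreover have "(q, y) \<in> Q" using q adj_sym by (auto simp: Q_def)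
        ultimately have "(x, y) \<in> Q\<^sup>*"
          by (meson converse_rtrancl_into_rtrancl rtrancl_into_rtrancl)
        then show ?thesis
          using chordal_common_boundary_adj[OF ch xy(5) nbX[OF xy(3)] nbX[OF xy(4)], of s] s xy XW WV
          by (auto simp: Q_def far_def)
      qed
    qed
    then show ?thesis using s by (auto simp: far_def)
  qed
qed

text \<open>Symmetry of the arcs turns connectedness into reachability of every vertex from
  \<open>w\<close>.\<close>

lemma connected_closed_eq_verts:
  assumes "Digraph_Component.connected G" and "w \<in> W" "w \<in> verts G"
    and closed: "\<And>x y. x \<in> W \<Longrightarrow> x \<rightarrow> y \<Longrightarrow> y \<in> W" and "x \<in> verts G"
  shows "x \<in> W"
proof -
  have "strongly_connected G"
    using assms(1) sym_arcs by (rule symmetric_connected_imp_strongly_connected[rotated])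
  then have "w \<rightarrow>\<^sup>* x" using assms by blast
  then show ?thesis
    by (induction rule: reachable_induct) (use assms in auto)
qed

end

section \<open>The exchange property of open neighbourhoods\<close>

locale total_uniform_graph = graph G for G (structure) +
  fixes k :: nat
  assumes uniform: "total_uniform k G"
begin

abbreviation "N \<equiv> neighbors G"

lemma N_subset_verts: "N x \<subseteq> verts G"
  using adj_in_verts by (auto simp: neighbors_def)

lemma N_nonempty: "x \<in> verts G \<Longrightarrow> N x \<noteq> {}"
  using uniform by (auto simp: total_uniform_def no_isolated_def)

section \<open>Lengths of legal and total dominating sequences\<close>

lemma card_total_dominating_set_ge:
  assumes "total_dominating_set G A"
  shows "k \<le> card A"
proof -
  have "finite {A. total_dominating_set G A}"
    by (rule finite_subset[of _ "Pow (verts G)"]) (auto simp: total_dominating_set_def)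
  then have "Min (card ` {A. total_dominating_set G A}) \<le> card A"
    using assms by (intro Min_le) auto
  then show ?thesis using uniform by (simp add: total_uniform_def total_domination_number_def)
qed

lemma length_legal_le_card_verts: "legal G vs \<Longrightarrow> length vs \<le> card (verts G)"
  unfolding legal_def by (metis card_mono distinct_card finite_verts)

lemma length_total_dominating_seq:
  assumes "total_dominating_seq G vs"
  shows "length vs = k"
proof (rule antisym)
  have "length ` {vs. total_dominating_seq G vs} \<subseteq> {..card (verts G)}"
    using length_legal_le_card_verts by (auto simp: total_dominating_seq_def)
  then have "finite (length ` {vs. total_dominating_seq G vs})"
    by (rule finite_subset) simp
  then have "length vs \<le> Max (length ` {vs. total_dominating_seq G vs})"
    using assms by (intro Max_ge) auto
  then show "length vs \<le> k"
    using uniform by (simp add: total_uniform_def grundy_total_domination_number_def)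
  show "k \<le> length vs"
    using assms card_total_dominating_set_ge[of "set vs"]
    by (simp add: total_dominating_seq_def legal_def distinct_card)
qed

lemma legal_snoc:
  assumes "legal G vs" "u \<in> verts G" "z \<in> N u" "\<And>w. w \<in> set vs \<Longrightarrow> z \<notin> N w"
  shows "legal G (vs @ [u])"
proof -
  have "N ((vs @ [u]) ! i) - (\<Union>j<i. N ((vs @ [u]) ! j)) \<noteq> {}"
    if "i \<in> {1..<length (vs @ [u])}" for i
  proof (cases "i < length vs")
    case True
    then have "N (vs ! i) - (\<Union>j<i. N (vs ! j)) \<noteq> {}"
      using assms(1) that by (auto simp: legal_def)
    then show ?thesis using True by (simp add: nth_append)
  next
    case False
    then have i: "i = length vs" using that by simp
    have "z \<notin> N ((vs @ [u]) ! j)" if "j < i" for j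
      using that i assms(4)[of "vs ! j"] by (simp add: nth_append)
    then show ?thesis using i assms(3) by auto
  qed
  moreover have "u \<notin> set vs" using assms(3,4) by blast
  ultimately show ?thesis using assms(1,2) by (auto simp: legal_def)
qed

lemma legal_Nil: "legal G []"
  by (simp add: legal_def)

text \<open>As long as some \<open>z\<close> is undominated, any neighbor of \<open>z\<close> can be
  appended, with \<open>z\<close> as its new neighbor. This carries the bound \<open>k\<close> from
  total dominating sequences over to all legal ones.\<close>

lemma legal_extend:
  assumes "legal G vs"
  shows "\<exists>ws. total_dominating_seq G (vs @ ws)"
  using assms
proof (induction "card (verts G) - length vs" arbitrary: vs rule: less_induct)
  case less
  show ?case
  proof (cases "total_dominating_set G (set vs)")
    case True
    then show ?thesis using less.prems
      by (intro exI[of _ "[]"]) (simp add: total_dominating_seq_def)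
  next
    case False
    then obtain z where z: "z \<in> verts G" "\<And>w. w \<in> set vs \<Longrightarrow> w \<notin> N z"
      using less.prems by (auto simp: total_dominating_set_def legal_def)
    obtain u where u: "u \<in> N z" using N_nonempty[OF z(1)] by blast
    have "legal G (vs @ [u])"
      using less.prems u z N_subset_verts adj_sym
      by (intro legal_snoc[of vs u z]) (auto simp: in_neighbors_iff)
    moreover from length_legal_le_card_verts[OF this]
    have "card (verts G) - length (vs @ [u]) < card (verts G) - length vs" by simp
    ultimately obtain ws where "total_dominating_seq G ((vs @ [u]) @ ws)"
      using less.hyps by blast
    then show ?thesis by (intro exI[of _ "u # ws"]) simp
  qed
qed

lemma length_legal_le: "legal G vs \<Longrightarrow> length vs \<le> k"
  using legal_extend[of vs] length_total_dominating_seq by fastforce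

text \<open>
  A legal sequence never contains a vertex that a later one makes redundant: deleting it from a
  total dominating extension would leave a total dominating set of size \<open>k - 1\<close>.
\<close>

lemma not_legal_redundant:
  assumes "legal G (vs @ [b, v])"
  shows "\<not> N b \<subseteq> N v \<union> (\<Union>w \<in> set vs. N w)"
proof
  assume sub: "N b \<subseteq> N v \<union> (\<Union>w \<in> set vs. N w)"
  obtain ws where ws: "total_dominating_seq G ((vs @ [b, v]) @ ws)"
    using legal_extend[OF assms] by blast
  let ?A = "set (vs @ v # ws)"
  have "\<exists>u \<in> ?A. u \<in> N z" if z: "z \<in> verts G" for z
  proof -
    obtain u where u: "u \<in> set (vs @ [b, v] @ ws)" "u \<in> N z"
      using ws z unfolding total_dominating_seq_def total_dominating_set_def by auto blast
    show ?thesis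
    proof (cases "u = b")
      case True
      then have "z \<in> N b" using u(2) by (simp add: in_neighbors_iff adj_sym)
      then obtain w where "w \<in> insert v (set vs)" "z \<in> N w" using sub by blast
      then show ?thesis by (intro bexI[of _ w]) (auto simp: in_neighbors_iff adj_sym)
    qed (use u in auto)
  qed
  then have "total_dominating_set G ?A"
    using ws by (auto simp: total_dominating_seq_def total_dominating_set_def)
  from card_total_dominating_set_ge[OF this] have "k \<le> length (vs @ v # ws)"
    using card_length le_trans by blast
  then show False using length_total_dominating_seq[OF ws] by simp
qed

text \<open>If the inclusion were strict, \<open>[b, v]\<close> would be legal although
  \<open>v\<close> makes \<open>b\<close> redundant. In matroid terms, each vertex spans a
  point.\<close>

lemma N_antichain:
  assumes "b \<in> verts G" "v \<in> verts G" "N b \<subseteq> N v"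
  shows "N b = N v"
proof (rule ccontr)
  assume "N b \<noteq> N v"
  then obtain z where z: "z \<in> N v" "z \<notin> N b" using assms by blast
  obtain y where "y \<in> N b" using N_nonempty[OF assms(1)] by blast
  then have "legal G ([] @ [b])"
    using assms legal_Nil by (intro legal_snoc[of "[]" b y]) auto
  then have "legal G ([b] @ [v])"
    using assms z by (intro legal_snoc[of "[b]" v z]) auto
  then show False using not_legal_redundant[of "[]" b v] assms by simp
qed

text \<open>If the conclusion failed, \<open>[a, b, v]\<close> would be legal although
  \<open>a\<close> and \<open>v\<close> make \<open>b\<close> redundant. This is the exchange axiom
  over the single point \<open>a\<close>.\<close>

lemma N_exchange:
  assumes "a \<in> verts G" "b \<in> verts G" "v \<in> verts G"
    and sub: "N b \<subseteq> N a \<union> N v" and nsub: "\<not> N b \<subseteq> N a"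
  shows "N v \<subseteq> N a \<union> N b"
proof (rule ccontr)
  assume "\<not> N v \<subseteq> N a \<union> N b"
  then obtain z where z: "z \<in> N v" "z \<notin> N a" "z \<notin> N b" by blast
  obtain x where x: "x \<in> N a" using N_nonempty[OF assms(1)] by blast
  obtain y where y: "y \<in> N b" "y \<notin> N a" using nsub by blast
  have "legal G ([] @ [a])"
    using assms x legal_Nil by (intro legal_snoc[of "[]" a x]) auto
  then have "legal G ([a] @ [b])"
    using assms y by (intro legal_snoc[of "[a]" b y]) auto
  then have "legal G ([a, b] @ [v])"
    using assms z by (intro legal_snoc[of "[a, b]" v z]) auto
  then show False using not_legal_redundant[of "[a]" b v] sub by auto
qed

text \<open>
  The common non-neighbours of \<open>a\<close> and \<open>b\<close> have rank at most \<open>k - 2\<close>, so together with \<open>c\<close> they do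
  not dominate all vertices; an undominated vertex is the required intersection point.
\<close>

lemma line_meets_hyperplane:
  assumes "a \<in> verts G" "b \<in> verts G" "c \<in> verts G" and ne: "N a \<noteq> N b"
  obtains w where "w \<in> verts G" "\<not> c \<rightarrow> w" "N w \<subseteq> N a \<union> N b"
proof -
  define P where "P = verts G - (N a \<union> N b)"
  define good where "good vs \<longleftrightarrow> legal G vs \<and> set vs \<subseteq> P" for vs
  have "good []" using legal_Nil by (simp add: good_def)
  moreover have "\<forall>vs. good vs \<longrightarrow> length vs < Suc k"
    using length_legal_le by (simp add: good_def less_Suc_eq_le)
  ultimately obtain s where gs: "good s" and max: "\<And>t. good t \<Longrightarrow> length t \<le> length s"
    using ex_has_greatest_nat[of good "[]" length "Suc k"] by metis
  have leg: "legal G s" and sP: "set s \<subseteq> P" using gs by (auto simp: good_def)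
  have spans: "N x \<subseteq> (\<Union>w \<in> set s. N w)" if "x \<in> P" for x
  proof
    fix z assume z: "z \<in> N x"
    show "z \<in> (\<Union>w \<in> set s. N w)"
    proof (rule ccontr)
      assume "z \<notin> (\<Union>w \<in> set s. N w)"
      then have "legal G (s @ [x])"
        using leg that z by (intro legal_snoc[of s x z]) (auto simp: P_def)
      then have "good (s @ [x])" using sP that by (auto simp: good_def)
      from max[OF this] show False by simp
    qed
  qed
  obtain p where p: "p \<in> N a" "p \<notin> N b" using ne N_antichain assms by blast
  obtain q where q: "q \<in> N b" using N_nonempty assms by blast
  \<comment> \<open>Members of \<open>s\<close> see neither \<open>a\<close> nor \<open>b\<close>,
    so \<open>a\<close> is a new neighbor for \<open>p\<close>, and \<open>b\<close> is one for
    \<open>q\<close> because \<open>p\<close> does not see \<open>b\<close>. Hence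
    \<open>length s + 2 \<le> k\<close>.\<close>
  have "legal G (s @ [p])"
    using leg p N_subset_verts sP adj_sym
    by (intro legal_snoc[of s p a]) (auto simp: P_def in_neighbors_iff)
  then have "legal G ((s @ [p]) @ [q])"
    using p q N_subset_verts sP adj_sym
    by (intro legal_snoc[of "s @ [p]" q b]) (auto simp: P_def in_neighbors_iff)
  from length_legal_le[OF this] have "length (c # s) < k" by simp
  then have "card (set (c # s)) < k" using card_length le_less_trans by blast
  then have "\<not> total_dominating_set G (set (c # s))"
    using card_total_dominating_set_ge not_le by blast
  then obtain w where w: "w \<in> verts G" "\<And>u. u \<in> set (c # s) \<Longrightarrow> u \<notin> N w"
    using sP assms(3) by (auto simp: total_dominating_set_def P_def)
  \<comment> \<open>A neighbor \<open>x\<close> of \<open>w\<close> outside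
    \<open>N a \<union> N b\<close> lies in \<open>P\<close>, so \<open>s\<close> covers
    \<open>N x\<close>, which contains \<open>w\<close>; but \<open>s\<close> leaves
    \<open>w\<close> undominated.\<close>
  have "N w \<subseteq> N a \<union> N b"
  proof
    fix x assume x: "x \<in> N w"
    show "x \<in> N a \<union> N b"
    proof (rule ccontr)
      assume "x \<notin> N a \<union> N b"
      then have "x \<in> P" using x N_subset_verts by (auto simp: P_def)
      moreover have "w \<in> N x" using x by (simp add: in_neighbors_iff adj_sym)
      ultimately obtain u where "u \<in> set s" "w \<in> N u" using spans by blast
      then show False using w(2)[of u] by (auto simp: in_neighbors_iff adj_sym)
    qed
  qed
  moreover have "\<not> c \<rightarrow> w" using w(2)[of c] adj_sym by (simp add: in_neighbors_iff)
  ultimately show thesis using that w(1) by blast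
qed

section \<open>Simplicial vertices of total uniform graphs\<close>

text \<open>Take \<open>y\<close> where the line through \<open>a\<close> and \<open>x\<close> meets
  the non-neighbors of \<open>b\<close>. As \<open>b\<close> sees \<open>x\<close> but not
  \<open>y\<close>, these are different points, so exchange puts \<open>a\<close> on the line
  through \<open>x\<close> and \<open>y\<close>; since \<open>v\<close> sees \<open>a\<close> but
  not \<open>x\<close>, it sees \<open>y\<close>.\<close>

lemma third_point:
  assumes "b \<rightarrow> x" "v \<rightarrow> a" "\<not> v \<rightarrow> x"
  obtains y where "\<not> b \<rightarrow> y" "v \<rightarrow> y" "N y \<subseteq> N a \<union> N x"
proof -
  have V: "a \<in> verts G" "x \<in> verts G" "b \<in> verts G" using assms adj_in_verts by auto
  have va: "v \<in> N a" "v \<notin> N x" using assms adj_sym by (auto simp: in_neighbors_iff)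
  then obtain y where y: "y \<in> verts G" "\<not> b \<rightarrow> y" "N y \<subseteq> N a \<union> N x"
    using line_meets_hyperplane[OF V] by blast
  have "b \<in> N x" "b \<notin> N y" using assms(1) y(2) adj_sym by (auto simp: in_neighbors_iff)
  then have "\<not> N y \<subseteq> N x" using N_antichain V y(1) by blast
  then have "N a \<subseteq> N x \<union> N y" using N_exchange[of x y a] V y by blast
  then have "v \<rightarrow> y" using va adj_sym by (auto simp: in_neighbors_iff)
  then show thesis using that y by blast
qed

section \<open>Two dominating vertices from a simplicial vertex\<close>

lemma total_dominating_pair_imp_k_le_2:
  assumes "total_dominating_set G {a, b}"
  shows "k \<le> 2"
proof -
  have "card {a, b} \<le> 2" by (simp add: card_insert_if)
  then show ?thesis using card_total_dominating_set_ge[OF assms] by simp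
qed

text \<open>By the antichain property all neighbors of \<open>a\<close> are leaves, so the connected
  graph is a star centered at \<open>a\<close>.\<close>

lemma leaf_imp_k_le_2:
  assumes con: "Digraph_Component.connected G" and v: "v \<in> verts G" and Nv: "N v = {a}"
  shows "k \<le> 2"
proof (rule total_dominating_pair_imp_k_le_2)
  have va: "v \<rightarrow> a" using Nv in_neighbors_iff by blast
  have a: "a \<in> verts G" using va adj_in_verts by blast
  have leaf: "N u = {a}" if "a \<rightarrow> u" for u
  proof -
    have "N v \<subseteq> N u" using that Nv adj_sym by (auto simp: in_neighbors_iff)
    then show ?thesis using N_antichain[of v u] v that adj_in_verts Nv by auto
  qed
  have "x \<in> insert a (N a)" if "x \<in> verts G" for x
  proof (rule connected_closed_eq_verts[OF con _ a _ that])
    show "a \<in> insert a (N a)" by simp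
    show "y \<in> insert a (N a)" if "x \<in> insert a (N a)" "x \<rightarrow> y" for x y
      using that leaf[of x] unfolding in_neighbors_iff[symmetric] by blast
  qed
  then show "total_dominating_set G {a, v}"
    using a v va leaf by (auto simp: total_dominating_set_def in_neighbors_iff adj_sym)
qed

lemma simplicial_two_neighbors_imp_k_le_2:
  assumes con: "Digraph_Component.connected G"
    and simp: "\<And>x y. v \<rightarrow> x \<Longrightarrow> v \<rightarrow> y \<Longrightarrow> x \<noteq> y \<Longrightarrow> x \<rightarrow> y"
    and va: "v \<rightarrow> a" and vb: "v \<rightarrow> b" and ab: "a \<noteq> b"
  shows "k \<le> 2"
proof -
  have vV: "v \<in> verts G" using va adj_in_verts by blast
  have not_sub: "\<not> N x \<subseteq> N y" if "x \<rightarrow> y" for x y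
    using that adj_irrefl in_neighbors_iff by blast
  have v_line: "N v \<subseteq> N c \<union> N d" if c: "v \<rightarrow> c" and d: "v \<rightarrow> d" and cd: "c \<noteq> d" for c d
  proof (rule ccontr)
    assume neg: "\<not> N v \<subseteq> N c \<union> N d"
    have V: "c \<in> verts G" "d \<in> verts G" using c d adj_in_verts by auto
    have adj: "c \<rightarrow> d" "d \<rightarrow> c" using simp[OF c d cd] adj_sym by auto
    \<comment> \<open>Exchange in contrapositive form provides a neighbor \<open>x\<close> of
      \<open>d\<close> that neither \<open>c\<close> nor \<open>v\<close> sees. The third point
      \<open>y\<close> on the line through \<open>c\<close> and \<open>x\<close> is not adjacent to
      \<open>c\<close>, so it equals \<open>c\<close> because \<open>v\<close> is simplicial; but
      \<open>d\<close> sees \<open>c\<close> and not \<open>y\<close>.\<close>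
    have "\<not> N d \<subseteq> N c \<union> N v"
      using N_exchange[of c d v] V vV neg not_sub adj by blast
    then obtain x where x: "d \<rightarrow> x" "\<not> c \<rightarrow> x" "\<not> v \<rightarrow> x"
      unfolding in_neighbors_iff[symmetric] by blast
    obtain y where y: "\<not> d \<rightarrow> y" "v \<rightarrow> y" "N y \<subseteq> N c \<union> N x"
      using third_point[OF x(1) c x(3)] .
    have "c \<notin> N y" using y(3) x(2) adj_sym[of x c] adj_irrefl by (auto simp: in_neighbors_iff)
    then have "y = c" using simp[OF y(2) c] in_neighbors_iff by blast
    then show False using y(1) adj by simp
  qed
  \<comment> \<open>The line through \<open>a\<close> and \<open>b\<close>, to be shown closed under
    adjacency.\<close>
  define L where "L = {x. N x \<subseteq> N a \<union> N b}"
  have adjL: "N x \<subseteq> N c \<union> N d"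
    if c: "v \<rightarrow> c" and d: "v \<rightarrow> d" and cd: "c \<noteq> d" and cx: "c \<rightarrow> x" for c d x
  proof -
    have V: "c \<in> verts G" "d \<in> verts G" "x \<in> verts G" using c d cx adj_in_verts by auto
    have adj: "c \<rightarrow> d" "d \<rightarrow> c" using simp[OF c d cd] adj_sym by auto
    show ?thesis
    proof (cases "v \<rightarrow> x")
      case True
      have "c \<noteq> x" using cx adj_irrefl by blast
      \<comment> \<open>Here \<open>v\<close> lies on the lines \<open>c x\<close> and
        \<open>c d\<close>, so exchange places \<open>x\<close> on the line \<open>c v\<close> and
        thus on \<open>c d\<close>.\<close>
      then have "N v \<subseteq> N c \<union> N x" using v_line c True by blast
      then have "N x \<subseteq> N c \<union> N v"
        using N_exchange[of c v x] V vV not_sub[OF c] by blast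
      then show ?thesis using v_line[OF c d cd] by blast
    next
      case False
      \<comment> \<open>Since \<open>c\<close> lies on the line \<open>d v\<close> and
        \<open>v\<close> does not see \<open>x\<close>, \<open>d\<close> must see \<open>x\<close>.
        The third point on the line \<open>c x\<close> is then \<open>d\<close> itself, because
        \<open>v\<close> is simplicial, and exchange moves \<open>x\<close> onto
        \<open>c d\<close>.\<close>
      have "N c \<subseteq> N d \<union> N v"
        using N_exchange[of d v c] V vV not_sub[OF d] v_line[OF c d cd] by blast
      then have dx: "d \<rightarrow> x" using cx False by (auto simp: in_neighbors_iff)
      obtain y where y: "\<not> d \<rightarrow> y" "v \<rightarrow> y" "N y \<subseteq> N c \<union> N x"
        using third_point[OF dx c False] .
      have "y = d" using simp[OF d y(2)] y(1) by blast
      then show ?thesis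
        using N_exchange[of c d x] V y(3) not_sub adj by blast
    qed
  qed
  have closed: "y \<in> L" if "x \<in> L" "x \<rightarrow> y" for x y
  proof -
    \<comment> \<open>A neighbor of any point of the line is a neighbor of \<open>a\<close> or
      \<open>b\<close>, so \<open>adjL\<close> in its two orientations suffices.\<close>
    have "a \<rightarrow> y \<or> b \<rightarrow> y" using that by (auto simp: L_def in_neighbors_iff)
    then show ?thesis using adjL[OF va vb ab] adjL[OF vb va ab[symmetric]] by (auto simp: L_def)
  qed
  have "v \<in> L" using v_line[OF va vb ab] by (simp add: L_def)
  from connected_closed_eq_verts[OF con this vV closed]
  have all: "x \<in> L" if "x \<in> verts G" for x using that by simp
  have "\<exists>u \<in> {a, b}. u \<in> N z" if z: "z \<in> verts G" for z
  proof -
    obtain x where x: "z \<rightarrow> x" using N_nonempty[OF z] by (auto simp: in_neighbors_iff)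
    then have "x \<in> L" using all adj_in_verts by blast
    then show ?thesis using x adj_sym by (auto simp: L_def in_neighbors_iff)
  qed
  then have "total_dominating_set G {a, b}"
    using va vb adj_in_verts by (auto simp: total_dominating_set_def)
  then show ?thesis by (rule total_dominating_pair_imp_k_le_2)
qed

lemma connected_chordal_imp_k_le_2:
  assumes con: "Digraph_Component.connected G" and "chordal G"
  shows "k \<le> 2"
proof -
  have "verts G \<noteq> {}"
    using con by (auto simp: connected_def strongly_connected_def)
  then obtain v where v: "v \<in> verts G"
    and simp: "\<And>x y. v \<rightarrow> x \<Longrightarrow> v \<rightarrow> y \<Longrightarrow> x \<noteq> y \<Longrightarrow> x \<rightarrow> y"
    using chordal_ex_simplicial[OF assms(2), of "verts G"] adj_in_verts(2) by blast
  obtain a where a: "v \<rightarrow> a" using N_nonempty[OF v] by (auto simp: in_neighbors_iff)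
  show ?thesis
  proof (cases "N v = {a}")
    case True
    then show ?thesis using leaf_imp_k_le_2 con v by blast
  next
    case False
    then obtain b where "v \<rightarrow> b" "a \<noteq> b" using a unfolding in_neighbors_iff[symmetric] by blast
    then show ?thesis using simplicial_two_neighbors_imp_k_le_2[OF con simp a] by blast
  qed
qed

end

theorem theorem5p2:
  fixes k :: nat
  assumes "k \<ge> 4"
  shows "\<not> (\<exists>G :: ('a, 'b) pre_digraph.
           graph G \<and> Digraph_Component.connected G \<and> chordal G \<and> total_uniform k G)"
proof
  assume "\<exists>G :: ('a, 'b) pre_digraph.
           graph G \<and> Digraph_Component.connected G \<and> chordal G \<and> total_uniform k G"
  then obtain G :: "('a, 'b) pre_digraph" where
    G: "graph G" "Digraph_Component.connected G" "chordal G" "total_uniform k G" by blast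
  interpret total_uniform_graph G k
    using G by (intro total_uniform_graph.intro total_uniform_graph_axioms.intro)
  show False using connected_chordal_imp_k_le_2[OF G(2,3)] assms by simp
qed

end
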